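(* Let $t>0$, let $i_1<\dots<i_M$ be real, let $\underline b=(b_2,\dots,b_{M-1})$ satisfy $-\frac{1}{i_{j+1}-i_j}<b_j<\frac{1}{i_j-i_{j-1}}$ for $j=2,\dots,M-1$, and let $\underline k\in\mathbb R_+^{M-2}$. Let $j\in\{2,\dots,M-1\}$. If $\lambda_j\to+\infty$ (along any sequence of vectors $\underline\lambda\in\mathbb R_+^{M-2}$), then the $j$th column of $\mathcal N_t(\underline k,\underline\lambda)^{-1}$ converges to the zero vector, and consequently, for any integer $p\ge1$, the $j$th column of $\mathcal N_t(\underline k,\underline\lambda)^{-p}$ converges to the zero vector.
   Context: Conventions: $\mathbb R_+=[0,\infty)$, $M\ge3$, $\underline\lambda=(\lambda_2,\dots,\lambda_{M-1})$. Set $\widetilde k_j=(i_{j+1}-i_j)(i_j-i_{j-1})k_j$ for $2\le j\le M-1$; for $2\le j\le M-1$, $q_{j,j+1}=\frac{i_j-i_{j-1}}{i_{j+1}-i_{j-1}}(1+(i_{j+1}-i_j)b_j)$, $q_{j,j-1}=\frac{i_{j+1}-i_j}{i_{j+1}-i_{j-1}}(1-(i_j-i_{j-1})b_j)$. $\mathcal N_t=\mathcal N_t(\underline k,\underline\lambda)$ is the $M\times M$ matrix whose first and last rows are those of the identity matrix and, for $2\le j\le M-1$, $\mathcal N_{t;j,j}=1+t\lambda_j(1+\widetilde k_j)$, $\mathcal N_{t;j,j+1}=-t\lambda_jq_{j,j+1}$, $\mathcal N_{t;j,j-1}=-t\lambda_jq_{j,j-1}$, all other entries $0$. *)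

theory Defs
  imports Complex_Main "Jordan_Normal_Form.Gauss_Jordan_Elimination"
begin

text \<open>
  The families \<open>x\<close> (the points $i_1 < \dots < i_M$), \<open>b\<close>, \<open>k\<close> and \<open>lam\<close> are functions on
  \<open>nat\<close> with 1-based indices: \<open>x\<close> matters only on \<open>{1..M}\<close>, the others only on
  \<open>{2..M - 1}\<close>.
\<close>

definition k_tilde :: "(nat \<Rightarrow> real) \<Rightarrow> (nat \<Rightarrow> real) \<Rightarrow> nat \<Rightarrow> real" where
  "k_tilde x k j = (x (j + 1) - x j) * (x j - x (j - 1)) * k j"

definition q_up :: "(nat \<Rightarrow> real) \<Rightarrow> (nat \<Rightarrow> real) \<Rightarrow> nat \<Rightarrow> real" where
  "q_up x b j = (x j - x (j - 1)) / (x (j + 1) - x (j - 1)) * (1 + (x (j + 1) - x j) * b j)"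

definition q_down :: "(nat \<Rightarrow> real) \<Rightarrow> (nat \<Rightarrow> real) \<Rightarrow> nat \<Rightarrow> real" where
  "q_down x b j = (x (j + 1) - x j) / (x (j + 1) - x (j - 1)) * (1 - (x j - x (j - 1)) * b j)"

text \<open>The entry in row \<open>j\<close> and column \<open>l\<close>, both counted from 1.\<close>

definition N_entry ::
  "nat \<Rightarrow> real \<Rightarrow> (nat \<Rightarrow> real) \<Rightarrow> (nat \<Rightarrow> real) \<Rightarrow> (nat \<Rightarrow> real) \<Rightarrow> (nat \<Rightarrow> real) \<Rightarrow> nat \<Rightarrow> nat \<Rightarrow> real"
where
  "N_entry M t x b k lam j l =
     (if j = 1 \<or> j = M then (if l = j then 1 else 0)
      else if l = j then 1 + t * lam j * (1 + k_tilde x k j)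
      else if l = j + 1 then - t * lam j * q_up x b j
      else if l + 1 = j then - t * lam j * q_down x b j
      else 0)"

text \<open>Rows and columns of \<open>mat\<close> are counted from 0, hence the shift.\<close>

definition N_mat ::
  "nat \<Rightarrow> real \<Rightarrow> (nat \<Rightarrow> real) \<Rightarrow> (nat \<Rightarrow> real) \<Rightarrow> (nat \<Rightarrow> real) \<Rightarrow> (nat \<Rightarrow> real) \<Rightarrow> real mat"
where
  "N_mat M t x b k lam = mat M M (\<lambda>(r, c). N_entry M t x b k lam (r + 1) (c + 1))"

text \<open>Meaningful only for invertible matrices; for others \<open>mat_inverse\<close> returns \<open>None\<close>.\<close>

definition inv_mat :: "real mat \<Rightarrow> real mat" where
  "inv_mat A = the (mat_inverse A)"

end

(*
  Every interior row of N_t is diagonally dominant with excess at least 1, because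
  q_{j,j+1} + q_{j,j-1} = 1 with both weights positive. So N_t obeys a comparison principle:
  N_t w >= 0 implies w >= 0. In particular N_t is invertible, and N_t y >= e_j implies that the
  j-th column of the inverse is bounded by y in absolute value. Taking y = (1,...,1) bounds all
  entries of the inverse by 1. Taking for y a vector v >= 0 that is strictly superharmonic for
  the weights q, with gap d_j > 0 at j, divided by t lambda_j d_j, bounds the j-th column by
  v / (t lambda_j d_j) uniformly in the other rates. Powers follow by multiplying with the
  bounded inverse.
*)
theory Submission
  imports Defs "Jordan_Normal_Form.Determinant"
begin

text \<open>\<open>pow_mat\<close> peels off a factor on the right. With the factor on the left, a
  column of the new power is the matrix applied to the same column of the old one.\<close>

lemma pow_mat_Suc_left:
  assumes A: "A \<in> carrier_mat n n"
  shows "A ^\<^sub>m Suc p = A * A ^\<^sub>m p"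
proof (induction p)
  case 0
  show ?case using A by simp
next
  case (Suc p)
  have "A ^\<^sub>m Suc (Suc p) = A ^\<^sub>m Suc p * A"
    by simp
  also have "\<dots> = A * A ^\<^sub>m p * A"
    by (simp only: Suc)
  also have "\<dots> = A * A ^\<^sub>m Suc p"
    using assoc_mult_mat[OF A pow_carrier_mat[OF A] A] by simp
  finally show ?case .
qed

section \<open>Grid points and nearest-neighbour weights\<close>

locale grid =
  fixes M :: nat and t :: real and x b k :: "nat \<Rightarrow> real"
  assumes M_ge: "M \<ge> 3"
    and t_pos: "t > 0"
    and x_mono: "strict_mono_on {1..M} x"
    and b_bounds: "\<forall>l\<in>{2..M - 1}. - (1 / (x (l + 1) - x l)) < b l \<and> b l < 1 / (x l - x (l - 1))"
    and k_nonneg: "\<forall>l\<in>{2..M - 1}. k l \<ge> 0"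
begin

lemma grid_steps:
  assumes "l \<in> {2..M - 1}"
  shows "x l < x (l + 1)" "x (l - 1) < x l"
  using assms M_ge by (auto intro!: strict_mono_onD[OF x_mono])

lemma k_tilde_nonneg: "l \<in> {2..M - 1} \<Longrightarrow> k_tilde x k l \<ge> 0"
  using grid_steps[of l] k_nonneg by (simp add: k_tilde_def)

text \<open>The lower bound on \<open>b l\<close> is exactly positivity of the last factor; the
  upper bound plays this role for \<open>q_down\<close>.\<close>

lemma q_up_pos:
  assumes "l \<in> {2..M - 1}"
  shows "q_up x b l > 0"
proof -
  have "0 < 1 + (x (l + 1) - x l) * b l"
    using b_bounds[rule_format, OF assms] grid_steps[OF assms] by (simp add: field_simps)
  then show ?thesis
    unfolding q_up_def using grid_steps[OF assms] by simp
qed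

lemma q_down_pos:
  assumes "l \<in> {2..M - 1}"
  shows "q_down x b l > 0"
proof -
  have "0 < 1 - (x l - x (l - 1)) * b l"
    using b_bounds[rule_format, OF assms] grid_steps[OF assms] by (simp add: field_simps)
  then show ?thesis
    unfolding q_down_def using grid_steps[OF assms] by simp
qed

text \<open>The terms containing \<open>b l\<close> cancel, and the two step lengths add up to the
  common denominator.\<close>

lemma q_up_add_q_down:
  assumes "l \<in> {2..M - 1}"
  shows "q_up x b l + q_down x b l = 1"
proof -
  have "x (l + 1) - x (l - 1) > 0"
    using grid_steps[OF assms] by simp
  then show ?thesis
    unfolding q_up_def q_down_def by (simp add: divide_simps) (simp add: algebra_simps)
qed

section \<open>Action of the matrix on vectors\<close>

definition nonneg_rates :: "(nat \<Rightarrow> real) \<Rightarrow> bool" where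
  "nonneg_rates lam \<longleftrightarrow> (\<forall>l\<in>{2..M - 1}. lam l \<ge> 0)"

abbreviation N :: "(nat \<Rightarrow> real) \<Rightarrow> real mat" where
  "N lam \<equiv> N_mat M t x b k lam"

lemma N_carrier [simp]: "N lam \<in> carrier_mat M M"
  by (simp add: N_mat_def)

lemma N_dim [simp]: "dim_row (N lam) = M" "dim_col (N lam) = M"
  by (simp_all add: N_mat_def)

lemma N_mult_vec_boundary:
  assumes "w \<in> carrier_vec M" "r < M" "r = 0 \<or> r = M - 1"
  shows "(N lam *\<^sub>v w) $ r = w $ r"
proof -
  have "(N lam *\<^sub>v w) $ r = (\<Sum>c = 0..<M. (if c = r then 1 else 0) * w $ c)"
    using assms by (auto simp: scalar_prod_def N_mat_def N_entry_def intro!: sum.cong)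
  also have "\<dots> = w $ r"
    using assms by (simp add: if_distrib[of "\<lambda>a. a * _"] cong: if_cong)
  finally show ?thesis .
qed

text \<open>Here \<open>l\<close> counts from 1 and vector positions from 0: \<open>w $ l\<close>
  and \<open>w $ (l - 2)\<close> are the right and left neighbours of
  \<open>w $ (l - 1)\<close>.\<close>

lemma N_mult_vec_interior:
  assumes "w \<in> carrier_vec M" "l \<in> {2..M - 1}"
  shows "(N lam *\<^sub>v w) $ (l - 1) =
    (1 + t * lam l * (1 + k_tilde x k l)) * w $ (l - 1)
    - t * lam l * (q_up x b l * w $ l + q_down x b l * w $ (l - 2))"
proof -
  let ?d = "1 + t * lam l * (1 + k_tilde x k l)"
  let ?u = "- t * lam l * q_up x b l" and ?o = "- t * lam l * q_down x b l"
  have l: "l \<ge> 2" "l < M" using assms M_ge by auto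
  have "(N lam *\<^sub>v w) $ (l - 1) = (\<Sum>c = 0..<M. N_entry M t x b k lam l (c + 1) * w $ c)"
    using assms l by (auto simp: scalar_prod_def N_mat_def intro!: sum.cong)
  \<comment> \<open>The three diagonals are disjoint, so the row splits into three indicator
    sums.\<close>
  also have "\<dots> = (\<Sum>c = 0..<M. (if c = l - 1 then ?d * w $ c else 0)
      + (if c = l then ?u * w $ c else 0) + (if c = l - 2 then ?o * w $ c else 0))"
    using l by (intro sum.cong) (auto simp: N_entry_def)
  also have "\<dots> = ?d * w $ (l - 1) + ?u * w $ l + ?o * w $ (l - 2)"
    using l less_imp_diff_less[of l M] by (simp add: sum.distrib)
  finally show ?thesis
    by (simp add: algebra_simps)
qed

lemma row_cases:
  assumes "r < M"
  obtains "r = 0 \<or> r = M - 1" | l where "l \<in> {2..M - 1}" "r = l - 1"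
  using assms M_ge by (cases "r = 0 \<or> r = M - 1") (auto intro: that(2)[of "r + 1"])

section \<open>Comparison principle and invertibility\<close>

text \<open>The discrete minimum principle: at an interior negative minimum the averaging property
  \<open>q_up_add_q_down\<close> would force the corresponding row of \<open>N lam *\<^sub>v w\<close> below the minimum.\<close>

lemma comparison:
  assumes lam: "nonneg_rates lam" and w: "w \<in> carrier_vec M"
    and Nw: "\<And>r. r < M \<Longrightarrow> (N lam *\<^sub>v w) $ r \<ge> 0" and r: "r < M"
  shows "w $ r \<ge> 0"
proof -
  obtain m where m: "m < M" and m_min: "\<And>i. i < M \<Longrightarrow> w $ m \<le> w $ i"
  proof -
    have fin: "finite ((\<lambda>i. w $ i) ` {..<M})" "(\<lambda>i. w $ i) ` {..<M} \<noteq> {}"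
      using r by auto
    then obtain m where "m < M" "w $ m = Min ((\<lambda>i. w $ i) ` {..<M})"
      using Min_in[OF fin] by (metis (no_types, lifting) imageE lessThan_iff)
    then show thesis
      using fin by (intro that[of m]) auto
  qed
  have "w $ m \<ge> 0"
    using m
  proof (cases rule: row_cases)
    case 1
    then show ?thesis
      using Nw[OF m] N_mult_vec_boundary[OF w m] by simp
  next
    case (2 l)
    have tl: "t * lam l \<ge> 0"
      using lam 2 t_pos by (simp add: nonneg_rates_def)
    have l: "l < M" "l - 2 < M" using 2 M_ge by auto
    have "w $ m = q_up x b l * w $ m + q_down x b l * w $ m"
      using q_up_add_q_down[OF 2(1)] by (simp flip: distrib_right)
    also have "\<dots> \<le> q_up x b l * w $ l + q_down x b l * w $ (l - 2)"
      using m_min[OF l(1)] m_min[OF l(2)] q_up_pos[OF 2(1)] q_down_pos[OF 2(1)]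
      by (intro add_mono mult_left_mono) auto
    finally have "t * lam l * w $ m \<le> t * lam l * (q_up x b l * w $ l + q_down x b l * w $ (l - 2))"
      by (rule mult_left_mono[OF _ tl])
    then have "0 \<le> (1 + t * lam l * k_tilde x k l) * w $ m"
      using Nw[OF m] N_mult_vec_interior[OF w 2(1), of lam] 2(2) by (simp add: algebra_simps)
    moreover have "1 + t * lam l * k_tilde x k l > 0"
      using tl k_tilde_nonneg[OF 2(1)] by (simp add: add_pos_nonneg)
    ultimately show ?thesis
      by (simp add: zero_le_mult_iff)
  qed
  then show ?thesis
    using m_min[OF r] by simp
qed

text \<open>Comparison applied to a kernel vector and to its negative forces it to vanish.\<close>

lemma det_N_nonzero:
  assumes "nonneg_rates lam"
  shows "det (N lam) \<noteq> 0"
proof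
  assume "det (N lam) = 0"
  then obtain v where v: "v \<in> carrier_vec M" "v \<noteq> 0\<^sub>v M" "N lam *\<^sub>v v = 0\<^sub>v M"
    using det_0_iff_vec_prod_zero_field[OF N_carrier] by blast
  have "N lam *\<^sub>v (- v) = 0\<^sub>v M"
    using v by (intro eq_vecI) (auto simp: vec_eq_iff)
  then have "v $ r = 0" if "r < M" for r
    using comparison[OF assms v(1), of r] comparison[OF assms, of "- v" r] v that by simp
  then show False
    using v by (auto simp: vec_eq_iff)
qed

text \<open>The nonzero determinant makes the matrix a unit, so \<open>mat_inverse\<close> returns
  \<open>Some B\<close> and \<open>the\<close> in \<open>inv_mat\<close> yields a genuine
  inverse.\<close>

lemma inv_N:
  assumes "nonneg_rates lam"
  shows "inv_mat (N lam) \<in> carrier_mat M M"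
    and "N lam * inv_mat (N lam) = 1\<^sub>m M"
    and "invertible_mat (N lam)"
proof -
  have "N lam \<in> Units (ring_mat TYPE(real) M ())"
    using det_non_zero_imp_unit[OF N_carrier det_N_nonzero[OF assms]] .
  then obtain B where B: "mat_inverse (N lam) = Some B"
    using mat_inverse(1)[OF N_carrier, of lam "()"] by (cases "mat_inverse (N lam)") auto
  note * = mat_inverse(2)[OF N_carrier B]
  then show "inv_mat (N lam) \<in> carrier_mat M M" "N lam * inv_mat (N lam) = 1\<^sub>m M"
    by (simp_all add: inv_mat_def B)
  show "invertible_mat (N lam)"
    using * by (auto simp: invertible_mat_def inverts_mat_def intro!: exI[of _ B])
qed

section \<open>Entrywise bounds on the inverse\<close>

lemma inv_N_entry_le:
  assumes lam: "nonneg_rates lam" and y: "y \<in> carrier_vec M" and c: "c < M"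
    and Ny: "\<And>r. r < M \<Longrightarrow> (N lam *\<^sub>v y) $ r \<ge> (if r = c then 1 else 0)"
    and r: "r < M"
  shows "\<bar>inv_mat (N lam) $$ (r, c)\<bar> \<le> y $ r"
proof -
  note inv = inv_N(1,2)[OF lam]
  let ?u = "col (inv_mat (N lam)) c"
  have u: "?u \<in> carrier_vec M" using inv(1) c by auto
  have "N lam *\<^sub>v ?u = unit_vec M c"
    using col_mult2[OF N_carrier inv(1) c, of lam] inv(2) c by simp
  \<comment> \<open>The image of \<open>y\<close> dominates the unit vector, which is the image of
    \<open>?u\<close>. Comparison then traps \<open>?u\<close> between \<open>- y\<close> and
    \<open>y\<close>.\<close>
  then have "(N lam *\<^sub>v (y + ?u)) $ i \<ge> 0" "(N lam *\<^sub>v (y - ?u)) $ i \<ge> 0" if "i < M" for i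
    using Ny[OF that] that c
    by (simp_all add: mult_add_distrib_mat_vec[OF N_carrier y u]
        mult_minus_distrib_mat_vec[OF N_carrier y u] unit_vec_def split: if_splits)
  then have "(y + ?u) $ r \<ge> 0" "(y - ?u) $ r \<ge> 0"
    using comparison[OF lam _ _ r] y u by (auto)
  then show ?thesis
    using u r c inv(1) by auto
qed

text \<open>On the constant vector the weighted average cancels \<open>t * lam l\<close>, so an
  interior row gives \<open>1 + t * lam l * k_tilde x k l\<close>, while a boundary row gives
  1.\<close>

lemma inv_N_entry_le_1:
  assumes lam: "nonneg_rates lam" and "c < M" "r < M"
  shows "\<bar>inv_mat (N lam) $$ (r, c)\<bar> \<le> 1"
proof -
  let ?y = "vec M (\<lambda>_. 1 :: real)"
  have "(N lam *\<^sub>v ?y) $ i \<ge> 1" if i: "i < M" for i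
    using i
  proof (cases rule: row_cases)
    case 1
    then show ?thesis using i N_mult_vec_boundary[of ?y i lam] by simp
  next
    case (2 l)
    have "l < M" "l - 2 < M" "l - 1 < M" using 2 M_ge by auto
    moreover have "0 \<le> t * (lam l * k_tilde x k l)"
      using lam 2 t_pos k_tilde_nonneg[OF 2(1)] by (simp add: nonneg_rates_def)
    ultimately show ?thesis
      using 2 N_mult_vec_interior[of ?y l lam] q_up_add_q_down[OF 2(1)]
      by (simp add: distrib_left del: index_mult_mat_vec)
  qed
  then have "(N lam *\<^sub>v ?y) $ i \<ge> (if i = c then 1 else 0)" if "i < M" for i
    using that by (smt (verit))
  from inv_N_entry_le[OF lam _ assms(2) this assms(3)] show ?thesis
    using assms by simp
qed

text \<open>Increments with ratio \<open>q_down / q_up\<close> would be harmonic;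
  \<open>q_down / 2\<close> is strictly smaller since \<open>q_up < 1\<close>. The empty product
  makes the first increment 1.\<close>

definition barrier_step :: "nat \<Rightarrow> real" where
  "barrier_step i = (\<Prod>m = 2..i. q_down x b m / 2)"

definition barrier :: "nat \<Rightarrow> real" where
  "barrier l = (\<Sum>i = 1..<l. barrier_step i)"

text \<open>Minus the generator of the walk that steps right with weight \<open>q_up\<close> and
  left with \<open>q_down\<close>, applied to \<open>barrier\<close>. The rates do not enter, so the
  gap at \<open>j\<close> stays fixed while \<open>lam j\<close> grows.\<close>

definition barrier_gap :: "nat \<Rightarrow> real" where
  "barrier_gap l = barrier l - (q_up x b l * barrier (l + 1) + q_down x b l * barrier (l - 1))"

lemma barrier_step_pos: "i < M \<Longrightarrow> barrier_step i > 0"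
  unfolding barrier_step_def by (intro prod_pos) (auto intro!: q_down_pos)

lemma barrier_nonneg: "l \<le> M \<Longrightarrow> barrier l \<ge> 0"
  unfolding barrier_def by (intro sum_nonneg less_imp_le barrier_step_pos) auto

text \<open>The increments of the barrier shrink by the factor \<open>q_down / 2\<close>, so that it is
  strictly superharmonic for the nearest-neighbour averages, whatever the rates are.\<close>

lemma barrier_gap_pos:
  assumes l: "l \<in> {2..M - 1}"
  shows "barrier_gap l > 0"
proof -
  obtain n where n: "l = Suc (Suc n)"
    using l that[of "l - 2"] by auto
  let ?s = "barrier_step (l - 1)"
  have up: "barrier (l + 1) = barrier l + barrier_step l"
    and down: "barrier l = barrier (l - 1) + ?s"
    by (simp_all add: barrier_def n)
  have step: "barrier_step l = q_down x b l / 2 * ?s"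
    by (simp add: barrier_step_def n)
  have "barrier_gap l = (1 - (q_up x b l + q_down x b l)) * barrier l
      + q_down x b l * ?s * (1 - q_up x b l / 2)"
    unfolding barrier_gap_def up step using down by (simp add: field_simps)
  also have "\<dots> = q_down x b l * ?s * (1 - q_up x b l / 2)"
    using q_up_add_q_down[OF l] by simp
  also have "\<dots> > 0"
    using q_up_add_q_down[OF l] q_down_pos[OF l] q_up_pos[OF l] barrier_step_pos[of "l - 1"] l
    by (intro mult_pos_pos) auto
  finally show ?thesis .
qed

lemma inv_N_column_le:
  assumes lam: "nonneg_rates lam" and j: "j \<in> {2..M - 1}" and pos: "lam j > 0" and r: "r < M"
  shows "\<bar>inv_mat (N lam) $$ (r, j - 1)\<bar> \<le> barrier (r + 1) / (t * barrier_gap j * lam j)"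
proof -
  \<comment> \<open>This scaling turns the contribution of the gap in row \<open>j\<close> into
    exactly 1.\<close>
  define C where "C = t * barrier_gap j * lam j"
  have C: "C > 0" using t_pos barrier_gap_pos[OF j] pos by (simp add: C_def)
  let ?y = "vec M (\<lambda>i. barrier (i + 1) / C)"
  have "(N lam *\<^sub>v ?y) $ i \<ge> (if i = j - 1 then 1 else 0)" if i: "i < M" for i
    using i
  proof (cases rule: row_cases)
    case 1
    then have "(N lam *\<^sub>v ?y) $ i = barrier (i + 1) / C"
      using i N_mult_vec_boundary[of ?y i lam] by simp
    then show ?thesis
      using 1 j i C barrier_nonneg[of "i + 1"] by auto
  next
    case (2 l)
    have tl: "t * lam l \<ge> 0"
      using lam 2 t_pos by (simp add: nonneg_rates_def)
    have l: "l < M" "l - 2 < M" "l - 1 < M" "l - Suc 0 < M" "Suc (l - 2) = l - 1" "Suc (l - 1) = l"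
      "Suc (l - Suc 0) = l"
      using 2 M_ge by auto
    have "(N lam *\<^sub>v ?y) $ i = (1 + t * lam l * (1 + k_tilde x k l)) * (barrier l / C)
        - t * lam l * (q_up x b l * (barrier (l + 1) / C) + q_down x b l * (barrier (l - 1) / C))"
      using 2 l N_mult_vec_interior[of ?y l lam] by (simp del: index_mult_mat_vec)
    also have "\<dots> =
        ((1 + t * lam l * k_tilde x k l) * barrier l + t * lam l * barrier_gap l) / C"
      using C by (simp add: barrier_gap_def field_simps)
    \<comment> \<open>The multiple of \<open>barrier l\<close> is nonnegative and is dropped; only
      the gap is kept.\<close>
    also have "\<dots> \<ge> t * lam l * barrier_gap l / C"
      using C tl k_tilde_nonneg[OF 2(1)] barrier_nonneg[of l] l
      by (intro divide_right_mono) simp_all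
    finally have *: "(N lam *\<^sub>v ?y) $ i \<ge> t * lam l * barrier_gap l / C" .
    show ?thesis
    proof (cases "i = j - 1")
      case True
      then have "l = j" using 2 j by auto
      then have "t * lam l * barrier_gap l / C = 1" using C by (auto simp: C_def)
      then show ?thesis using * True by (simp only: if_True refl)
    next
      case False
      have "t * lam l * barrier_gap l / C \<ge> 0"
        using tl C barrier_gap_pos[OF 2(1)] by simp
      then show ?thesis using * False by simp
    qed
  qed
  from inv_N_entry_le[OF lam _ _ this r] show ?thesis
    using r j unfolding C_def by auto
qed

end

theorem lemma7p3:
  fixes M j :: nat and t :: real
    and x b k :: "nat \<Rightarrow> real"
    and lam :: "nat \<Rightarrow> nat \<Rightarrow> real"
  assumes "M \<ge> 3"
    and "t > 0"
    and "strict_mono_on {1..M} x"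
    and "\<forall>l\<in>{2..M - 1}. - (1 / (x (l + 1) - x l)) < b l \<and> b l < 1 / (x l - x (l - 1))"
    and "\<forall>l\<in>{2..M - 1}. k l \<ge> 0"
    and "j \<in> {2..M - 1}"
    and "\<forall>n. \<forall>l\<in>{2..M - 1}. lam n l \<ge> 0"
    and "filterlim (\<lambda>n. lam n j) at_top sequentially"
  shows "(\<forall>n. invertible_mat (N_mat M t x b k (lam n))) \<and>
    (\<forall>r<M. (\<lambda>n. col (inv_mat (N_mat M t x b k (lam n))) (j - 1) $ r) \<longlonglongrightarrow> 0) \<and>
    (\<forall>p\<ge>1. \<forall>r<M. (\<lambda>n. col (inv_mat (N_mat M t x b k (lam n)) ^\<^sub>m p) (j - 1) $ r) \<longlonglongrightarrow> 0)"
proof -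
  interpret grid M t x b k
    using assms by unfold_locales
  have rates: "nonneg_rates (lam n)" for n
    using assms(7) by (simp add: nonneg_rates_def)
  define A where "A n = inv_mat (N (lam n))" for n
  have A [simp]: "A n \<in> carrier_mat M M" for n
    using inv_N(1)[OF rates] by (simp add: A_def)
  have dim [simp]: "dim_row (A n) = M" "dim_col (A n) = M" for n
    using carrier_matD[OF A[of n]] by blast+
  have j: "j - 1 < M" using assms(6) by auto
  have entry: "col (A n ^\<^sub>m p) (j - 1) $ r = (A n ^\<^sub>m p) $$ (r, j - 1)" if "r < M" for n p r
    using that j pow_carrier_mat[OF A[of n], of p] by auto
  have lim1: "(\<lambda>n. A n $$ (r, j - 1)) \<longlonglongrightarrow> 0" if r: "r < M" for r
  proof (rule tendsto_0_le[where K = 1])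
    show "\<forall>\<^sub>F n in sequentially. norm (A n $$ (r, j - 1))
        \<le> norm (barrier (r + 1) / (t * barrier_gap j * lam n j)) * 1"
      \<comment> \<open>The column bound requires \<open>lam n j > 0\<close>, which holds
        eventually.\<close>
      using filterlim_at_top_dense[THEN iffD1, OF assms(8), rule_format, of 0]
    proof eventually_elim
      case (elim n)
      show ?case
        using order_trans[OF inv_N_column_le[OF rates assms(6) elim r] abs_ge_self]
        unfolding A_def by simp
    qed
    have "t * barrier_gap j > 0"
      using t_pos barrier_gap_pos[OF assms(6)] by simp
    then have "filterlim (\<lambda>n. t * barrier_gap j * lam n j) at_top sequentially"
      using assms(8) by (rule filterlim_tendsto_pos_mult_at_top[OF tendsto_const])
    then show "(\<lambda>n. barrier (r + 1) / (t * barrier_gap j * lam n j)) \<longlonglongrightarrow> 0"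
      by (intro tendsto_divide_0[OF tendsto_const] filterlim_at_top_imp_at_infinity)
  qed
  \<comment> \<open>The induction starts at exponent 1, because the zeroth power is the identity,
    whose columns do not vanish.\<close>
  have limp: "\<forall>r<M. (\<lambda>n. (A n ^\<^sub>m Suc p) $$ (r, j - 1)) \<longlonglongrightarrow> 0" for p
  proof (induction p)
    case 0
    show ?case using lim1 by simp
  next
    case (Suc p)
    show ?case
    proof (intro allI impI)
      fix r assume r: "r < M"
      have "(A n ^\<^sub>m Suc (Suc p)) $$ (r, j - 1)
          = (\<Sum>i = 0..<M. A n $$ (r, i) * (A n ^\<^sub>m Suc p) $$ (i, j - 1))" for n
      proof -
        have "A n ^\<^sub>m Suc (Suc p) = A n * A n ^\<^sub>m Suc p"
          by (rule pow_mat_Suc_left[OF A])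
        then show ?thesis
          using r j pow_carrier_mat[OF A[of n], of "Suc p"]
          by (simp add: scalar_prod_def del: pow_mat.simps)
      qed
      moreover have "(\<lambda>n. A n $$ (r, i) * (A n ^\<^sub>m Suc p) $$ (i, j - 1)) \<longlonglongrightarrow> 0"
        if i: "i < M" for i
      \<comment> \<open>The entries of \<open>A n\<close> are at most 1 in absolute value uniformly
        in \<open>n\<close>, so each summand is dominated by the entry of the lower power.\<close>
      proof (rule tendsto_0_le[where K = 1])
        show "(\<lambda>n. (A n ^\<^sub>m Suc p) $$ (i, j - 1)) \<longlonglongrightarrow> 0"
          using Suc i by blast
        show "\<forall>\<^sub>F n in sequentially. norm (A n $$ (r, i) * (A n ^\<^sub>m Suc p) $$ (i, j - 1))
            \<le> norm ((A n ^\<^sub>m Suc p) $$ (i, j - 1)) * 1"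
          using inv_N_entry_le_1[OF rates i r]
          by (intro always_eventually allI) (simp add: A_def abs_mult mult_left_le_one_le)
      qed
      ultimately show "(\<lambda>n. (A n ^\<^sub>m Suc (Suc p)) $$ (r, j - 1)) \<longlonglongrightarrow> 0"
        by (simp only:) (auto intro!: tendsto_null_sum)
    qed
  qed
  have powers: "(\<lambda>n. col (A n ^\<^sub>m p) (j - 1) $ r) \<longlonglongrightarrow> 0" if "p \<ge> 1" "r < M" for p r
    using limp[of "p - 1"] that unfolding entry[OF that(2)] by (simp del: pow_mat.simps)
  have "(\<lambda>n. col (A n) (j - 1) $ r) \<longlonglongrightarrow> 0" if "r < M" for r
    using lim1[OF that] that j by simp
  with powers inv_N(3)[OF rates] show ?thesis
    unfolding A_def by blast
qed

end
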